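(* For every $n\ge 1$, the group $E\Pi A(\mathrm N_{n,2})$ of elementary palindromic automorphisms of the free nilpotent group of rank $n$ and step $2$ is isomorphic to the group $E\Pi A(\mathrm N_{n,1})$ of elementary palindromic automorphisms of the free abelian group of rank $n$.
   Context: $F_n$ is the free group on $x_1,\dots,x_n$, and $\mathrm N_{n,k}=F_n/\gamma_{k+1}F_n$, where $\gamma_mF_n$ is the $m$-th term of the lower central series ($\gamma_1F_n=F_n$); the images of the $x_i$ in $\mathrm N_{n,k}$ are again denoted $x_i$. For $g\in \mathrm N_{n,k}$ represented by a word $w$ in $x_1^{\pm1},\dots,x_n^{\pm1}$, $\overline g$ denotes the element represented by the reverse word (the letters $x_j^{\pm1}$ of $w$ written in the opposite order); this is well defined. An elementary palindromic automorphism of $\mathrm N_{n,k}$ is an automorphism of the form $x_i\mapsto \overline{p_i}\,x_i\,p_i$ ($1\le i\le n$) for some $p_1,\dots,p_n\in\mathrm N_{n,k}$. $E\Pi A(\mathrm N_{n,k})$ is the set of all elementary palindromic automorphisms of $\mathrm N_{n,k}$; it is a group under composition. *)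

theory Defs
  imports "HOL-Algebra.Bij" "HOL-Algebra.Generated_Groups"
begin

section \<open>The free group on $x_1, \dots, x_n$\<close>

text \<open>The letter \<open>(i, True)\<close> stands for $x_i$ and \<open>(i, False)\<close> for $x_i^{-1}$.\<close>

type_synonym word = "(nat \<times> bool) list"

definition words :: "nat \<Rightarrow> word set"
  where "words n = lists ({1..n} \<times> UNIV)"

inductive_set free_eq :: "nat \<Rightarrow> (word \<times> word) set" for n :: nat
  where
    refl: "w \<in> words n \<Longrightarrow> (w, w) \<in> free_eq n"
  | sym: "(u, v) \<in> free_eq n \<Longrightarrow> (v, u) \<in> free_eq n"
  | trans: "(u, v) \<in> free_eq n \<Longrightarrow> (v, w) \<in> free_eq n \<Longrightarrow> (u, w) \<in> free_eq n"
  | cancel: "u \<in> words n \<Longrightarrow> v \<in> words n \<Longrightarrow> i \<in> {1..n} \<Longrightarrow>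
      (u @ [(i, b), (i, \<not> b)] @ v, u @ v) \<in> free_eq n"

definition word_class :: "nat \<Rightarrow> word \<Rightarrow> word set"
  where "word_class n w = free_eq n `` {w}"

definition free_group :: "nat \<Rightarrow> word set monoid"
  where "free_group n =
    \<lparr>carrier = words n // free_eq n,
     mult = \<lambda>A B. \<Union>a\<in>A. \<Union>b\<in>B. word_class n (a @ b),
     one = word_class n []\<rparr>"

lemma free_eq_in_words: "(u, v) \<in> free_eq n \<Longrightarrow> u \<in> words n \<and> v \<in> words n"
  by (induction rule: free_eq.induct) (auto simp: words_def)

lemma equiv_free_eq: "equiv (words n) (free_eq n)"
proof (rule equivI)
  show "free_eq n \<subseteq> words n \<times> words n"
    using free_eq_in_words by auto
  show "refl_on (words n) (free_eq n)"
    using free_eq_in_words free_eq.refl by (auto simp: refl_on_def)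
  show "Relation.sym (free_eq n)"
    by (auto intro: symI free_eq.sym)
  show "Relation.trans (free_eq n)"
    by (rule transI) (rule free_eq.trans)
qed

lemma free_eq_append_right:
  assumes "(u, v) \<in> free_eq n" "w \<in> words n"
  shows "(u @ w, v @ w) \<in> free_eq n"
  using assms
proof (induction rule: free_eq.induct)
  case (cancel u v i b)
  then show ?case
    using free_eq.cancel[of u n "v @ w" i b] by (auto simp: words_def)
qed (auto intro: free_eq.intros simp: words_def)

lemma free_eq_append_left:
  assumes "(u, v) \<in> free_eq n" "w \<in> words n"
  shows "(w @ u, w @ v) \<in> free_eq n"
  using assms
proof (induction rule: free_eq.induct)
  case (cancel u v i b)
  then show ?case
    using free_eq.cancel[of "w @ u" n v i b] by (auto simp: words_def)
qed (auto intro: free_eq.intros simp: words_def)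

lemma free_eq_append:
  assumes "(u, u') \<in> free_eq n" "(v, v') \<in> free_eq n"
  shows "(u @ v, u' @ v') \<in> free_eq n"
  by (meson assms free_eq.trans free_eq_append_left free_eq_append_right free_eq_in_words)

lemma free_eq_rev:
  assumes "(u, v) \<in> free_eq n"
  shows "(rev u, rev v) \<in> free_eq n"
  using assms
proof (induction rule: free_eq.induct)
  case (cancel u v i b)
  then show ?case
    using free_eq.cancel[of "rev v" n "rev u" i "\<not> b"] by (simp add: words_def in_lists_conv_set)
next
  case (refl w)
  then show ?case
    by (intro free_eq.refl) (simp add: words_def in_lists_conv_set)
qed (blast intro: free_eq.sym free_eq.trans)+

lemma word_class_eq_iff:
  assumes "u \<in> words n" "v \<in> words n"
  shows "word_class n u = word_class n v \<longleftrightarrow> (u, v) \<in> free_eq n"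
  using eq_equiv_class_iff[OF equiv_free_eq assms] by (simp add: word_class_def)

lemma carrier_free_group: "carrier (free_group n) = word_class n ` words n"
  by (auto simp: free_group_def quotient_def word_class_def)

lemma mult_word_class:
  assumes "u \<in> words n" "v \<in> words n"
  shows "word_class n u \<otimes>\<^bsub>free_group n\<^esub> word_class n v = word_class n (u @ v)"
proof -
  have *: "word_class n (a @ b) = word_class n (u @ v)"
    if "a \<in> word_class n u" "b \<in> word_class n v" for a b
  proof -
    have "(u @ v, a @ b) \<in> free_eq n"
      using that by (simp add: word_class_def free_eq_append)
    then show ?thesis
      by (metis free_eq_in_words word_class_eq_iff)
  qed
  have "u \<in> word_class n u" "v \<in> word_class n v"
    using assms by (auto simp: word_class_def intro: free_eq.refl)
  then have "(\<Union>a\<in>word_class n u. \<Union>b\<in>word_class n v. word_class n (a @ b)) =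
      word_class n (u @ v)"
    using * by blast
  then show ?thesis
    by (simp add: free_group_def)
qed

lemma words_append: "u \<in> words n \<Longrightarrow> v \<in> words n \<Longrightarrow> u @ v \<in> words n"
  by (auto simp: words_def)

lemma words_Nil: "[] \<in> words n"
  by (auto simp: words_def)

lemma words_rev: "rev w \<in> words n \<longleftrightarrow> w \<in> words n"
  by (auto simp: words_def)

lemma word_class_inverse:
  assumes "w \<in> words n"
  shows "\<exists>v\<in>words n. (v @ w, []) \<in> free_eq n"
  using assms
proof (induction w)
  case Nil
  then show ?case using words_Nil free_eq.refl by fastforce
next
  case (Cons a w)
  obtain i b where a: "a = (i, b)" by (cases a)
  have i: "i \<in> {1..n}" and w: "w \<in> words n"
    using Cons.prems by (simp_all add: words_def a)
  obtain v where v: "v \<in> words n" "(v @ w, []) \<in> free_eq n"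
    using Cons.IH w by blast
  have "(v @ [(i, \<not> b), (i, \<not> \<not> b)] @ w, v @ w) \<in> free_eq n"
    by (rule free_eq.cancel[OF v(1) w i])
  from free_eq.trans[OF this v(2)] have "((v @ [(i, \<not> b)]) @ a # w, []) \<in> free_eq n"
    by (simp add: a)
  moreover have "v @ [(i, \<not> b)] \<in> words n"
    using v i by (auto simp: words_def)
  ultimately show ?case by blast
qed

lemma group_free_group: "group (free_group n)"
proof (rule groupI)
  show "\<one>\<^bsub>free_group n\<^esub> \<in> carrier (free_group n)"
    by (simp add: carrier_free_group words_Nil) (simp add: free_group_def words_Nil)
next
  fix x assume x: "x \<in> carrier (free_group n)"
  then obtain w where w: "w \<in> words n" "x = word_class n w"
    by (auto simp: carrier_free_group)
  have one: "\<one>\<^bsub>free_group n\<^esub> = word_class n []"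
    by (simp add: free_group_def)
  show "\<one>\<^bsub>free_group n\<^esub> \<otimes>\<^bsub>free_group n\<^esub> x = x"
    using w by (simp add: one mult_word_class words_Nil)
  obtain v where v: "v \<in> words n" "(v @ w, []) \<in> free_eq n"
    using word_class_inverse w by blast
  have "word_class n v \<otimes>\<^bsub>free_group n\<^esub> x = \<one>\<^bsub>free_group n\<^esub>"
    using v w by (simp add: one mult_word_class word_class_eq_iff words_append words_Nil)
  then show "\<exists>y\<in>carrier (free_group n). y \<otimes>\<^bsub>free_group n\<^esub> x = \<one>\<^bsub>free_group n\<^esub>"
    using v by (auto simp: carrier_free_group)
qed (auto simp: carrier_free_group mult_word_class words_append)


section \<open>Lower central series\<close>

text \<open>Indexed so that $\gamma_1 G = G$; the value at \<open>0\<close> is a dummy.\<close>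

fun lower_central :: "('a, 'b) monoid_scheme \<Rightarrow> nat \<Rightarrow> 'a set"
  where
    "lower_central G 0 = carrier G"
  | "lower_central G (Suc 0) = carrier G"
  | "lower_central G (Suc (Suc m)) =
      generate G {a \<otimes>\<^bsub>G\<^esub> b \<otimes>\<^bsub>G\<^esub> inv\<^bsub>G\<^esub> a \<otimes>\<^bsub>G\<^esub> inv\<^bsub>G\<^esub> b |a b.
        a \<in> lower_central G (Suc m) \<and> b \<in> carrier G}"

lemma (in group) normal_carrier: "carrier G \<lhd> G"
  by (rule normal_invI) (auto simp: subgroup_self)

lemma (in group) lower_central_normal: "lower_central G m \<lhd> G"
proof (induction m rule: induct_nat_012)
  case (ge2 m)
  let ?A = "lower_central G (Suc m)"
  have A: "?A \<subseteq> carrier G"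
    using ge2 by (simp add: normal_imp_subgroup subgroup.subset)
  show ?case
    unfolding lower_central.simps
  proof (rule normal_generateI)
    fix h g
    assume "h \<in> {a \<otimes> b \<otimes> inv a \<otimes> inv b |a b. a \<in> ?A \<and> b \<in> carrier G}"
      and g: "g \<in> carrier G"
    then obtain a b where h: "a \<in> ?A" "b \<in> carrier G" "h = a \<otimes> b \<otimes> inv a \<otimes> inv b"
      by auto
    have a: "a \<in> carrier G" using h A by auto
    have 1: "g \<otimes> a \<otimes> inv g \<in> ?A"
      using ge2(2) g h(1) by (simp add: normal_inv_iff)
    have "g \<otimes> h \<otimes> inv g = (g \<otimes> a \<otimes> inv g) \<otimes> (g \<otimes> b \<otimes> inv g)
        \<otimes> inv (g \<otimes> a \<otimes> inv g) \<otimes> inv (g \<otimes> b \<otimes> inv g)"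
    proof -
      have [simp]: "inv g \<otimes> (g \<otimes> x) = x" if "x \<in> carrier G" for x
        using g that by (simp flip: m_assoc)
      show ?thesis
        using a h g by (simp add: m_assoc inv_mult_group)
    qed
    then show "g \<otimes> h \<otimes> inv g \<in> {a \<otimes> b \<otimes> inv a \<otimes> inv b |a b. a \<in> ?A \<and> b \<in> carrier G}"
      using 1 g h by blast
  qed (use A in auto)
qed (auto simp: normal_carrier)

lemma (in group) antihom_lower_central:
  assumes r: "\<And>x. x \<in> carrier G \<Longrightarrow> r x \<in> carrier G"
    and anti: "\<And>x y. x \<in> carrier G \<Longrightarrow> y \<in> carrier G \<Longrightarrow> r (x \<otimes> y) = r y \<otimes> r x"
    and "x \<in> lower_central G m"
  shows "r x \<in> lower_central G m"
  using assms(3)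
proof (induction m arbitrary: x rule: induct_nat_012)
  case (ge2 m)
  let ?A = "lower_central G (Suc m)"
  let ?C = "{a \<otimes> b \<otimes> inv a \<otimes> inv b |a b. a \<in> ?A \<and> b \<in> carrier G}"
  interpret A: subgroup ?A G
    using lower_central_normal normal_imp_subgroup by blast
  have r1: "r \<one> = \<one>"
  proof -
    have "r \<one> \<otimes> r \<one> = r \<one>"
      using anti[of \<one> \<one>] by simp
    then show ?thesis
      using r_cancel_one[OF r r] by blast
  qed
  have rinv: "r (inv y) = inv (r y)" if "y \<in> carrier G" for y
  proof -
    have "r (inv y) \<otimes> r y = \<one>"
      using that r1 by (simp flip: anti)
    then show ?thesis
      using that r by (simp add: inv_equality)
  qed
  have C: "?C \<subseteq> carrier G" by auto
  have rC: "r h \<in> generate G ?C" if h: "h \<in> ?C" for h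
  proof -
    obtain a b where h: "a \<in> ?A" "b \<in> carrier G" "h = a \<otimes> b \<otimes> inv a \<otimes> inv b"
      using h by auto
    have ra: "r a \<in> ?A" using ge2.IH(2) h(1) by blast
    let ?c = "inv (r a) \<otimes> inv (r b) \<otimes> inv (inv (r a)) \<otimes> inv (inv (r b))"
    have "?c \<in> ?C" using ra h(2) r by blast
    moreover have "r h = inv ?c"
      using h ra r by (simp add: anti rinv m_assoc inv_mult_group)
    ultimately show ?thesis by (simp add: generate.inv)
  qed
  have "x \<in> generate G ?C" using ge2.prems by simp
  then have "r x \<in> generate G ?C"
  proof (induction rule: generate.induct)
    case one
    then show ?case by (simp add: r1 generate.one)
  next
    case (incl h)
    then show ?case by (rule rC)
  next
    case (inv h)
    then show ?case
      using rinv[OF subsetD[OF C inv]] generate_m_inv_closed[OF C rC[OF inv]] by (simp only:)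
  next
    case (eng h1 h2)
    have "r (h1 \<otimes> h2) = r h2 \<otimes> r h1"
      using eng(1,2) by (intro anti generate_in_carrier[OF C])
    then show ?case
      using generate.eng[OF eng(4,3)] by (simp only:)
  qed
  then show ?case by simp
qed (auto simp: r)


section \<open>The free nilpotent group of rank \<open>n\<close> and step \<open>k\<close>\<close>

definition free_nilpotent :: "nat \<Rightarrow> nat \<Rightarrow> word set set monoid"
  where "free_nilpotent n k = free_group n Mod lower_central (free_group n) (k + 1)"

definition word_elt :: "nat \<Rightarrow> nat \<Rightarrow> word \<Rightarrow> word set set"
  where "word_elt n k w =
    lower_central (free_group n) (k + 1) #>\<^bsub>free_group n\<^esub> word_class n w"

definition gen :: "nat \<Rightarrow> nat \<Rightarrow> nat \<Rightarrow> word set set"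
  where "gen n k i = word_elt n k [(i, True)]"

text \<open>The reverse of the element represented by \<open>w\<close>; independence of the choice of
  \<open>w\<close>, and hence uniqueness of \<open>h\<close>, is lemma \<open>bar_word_elt\<close> below.\<close>

definition bar :: "nat \<Rightarrow> nat \<Rightarrow> word set set \<Rightarrow> word set set"
  where "bar n k g =
    (THE h. \<exists>w \<in> words n. g = word_elt n k w \<and> h = word_elt n k (rev w))"

lemma group_free_nilpotent: "group (free_nilpotent n k)"
  unfolding free_nilpotent_def
  by (intro normal.factorgroup_is_group group.lower_central_normal group_free_group)

lemma carrier_free_nilpotent: "carrier (free_nilpotent n k) = word_elt n k ` words n"
  by (auto simp: free_nilpotent_def FactGroup_def RCOSETS_def carrier_free_group word_elt_def)

lemma word_elt_rev_cong:
  assumes u: "u \<in> words n" and v: "v \<in> words n" and eq: "word_elt n k u = word_elt n k v"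
  shows "word_elt n k (rev u) = word_elt n k (rev v)"
proof -
  let ?F = "free_group n"
  let ?N = "lower_central ?F (k + 1)"
  interpret F: group ?F by (rule group_free_group)
  interpret N: normal ?N ?F by (rule F.lower_central_normal)
  define r where "r A = word_class n (rev (SOME w. w \<in> words n \<and> A = word_class n w))" for A
  have r_class: "r (word_class n w) = word_class n (rev w)" if w: "w \<in> words n" for w
  proof -
    let ?v = "SOME v. v \<in> words n \<and> word_class n w = word_class n v"
    have v: "?v \<in> words n \<and> word_class n w = word_class n ?v"
      by (rule someI[of _ w]) (simp add: w)
    then have "(?v, w) \<in> free_eq n"
      using word_class_eq_iff[OF w, of ?v] by (blast intro: free_eq.sym)
    from free_eq_rev[OF this] have "word_class n (rev ?v) = word_class n (rev w)"
      using free_eq_in_words by (subst word_class_eq_iff) blast+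
    then show ?thesis
      unfolding r_def .
  qed
  have r: "r x \<in> carrier ?F" if "x \<in> carrier ?F" for x
    using that r_class by (auto simp: carrier_free_group words_rev)
  have anti: "r (x \<otimes>\<^bsub>?F\<^esub> y) = r y \<otimes>\<^bsub>?F\<^esub> r x"
    if "x \<in> carrier ?F" "y \<in> carrier ?F" for x y
    using that r_class by (auto simp: carrier_free_group words_rev mult_word_class words_append)
  let ?u = "word_class n u" and ?v = "word_class n v"
  have cu: "?u \<in> carrier ?F" and cv: "?v \<in> carrier ?F"
    using u v by (auto simp: carrier_free_group)
  have "?u \<in> ?N #>\<^bsub>?F\<^esub> ?v"
    using eq F.rcos_self[OF cu N.subgroup_axioms] by (simp only: word_elt_def)
  then obtain h where h: "h \<in> ?N" "?u = h \<otimes>\<^bsub>?F\<^esub> ?v"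
    by (auto simp: r_coset_def)
  have rh: "r h \<in> ?N"
    by (rule F.antihom_lower_central[OF r anti h(1)])
  have "r ?u = r ?v \<otimes>\<^bsub>?F\<^esub> r h"
    unfolding h(2) by (rule anti[OF subsetD[OF N.subset h(1)] cv])
  then have "r ?u = (r ?v \<otimes>\<^bsub>?F\<^esub> r h \<otimes>\<^bsub>?F\<^esub> inv\<^bsub>?F\<^esub> r ?v) \<otimes>\<^bsub>?F\<^esub> r ?v"
    using r[OF cv] subsetD[OF N.subset rh] by (simp add: F.m_assoc)
  moreover have "r ?v \<otimes>\<^bsub>?F\<^esub> r h \<otimes>\<^bsub>?F\<^esub> inv\<^bsub>?F\<^esub> r ?v \<in> ?N"
    using rh r[OF cv] by (rule N.inv_op_closed2[rotated])
  ultimately have "r ?u \<in> ?N #>\<^bsub>?F\<^esub> r ?v"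
    by (auto simp: r_coset_def)
  then have "?N #>\<^bsub>?F\<^esub> r ?u = ?N #>\<^bsub>?F\<^esub> r ?v"
    using F.repr_independence[OF _ r[OF cv] N.subgroup_axioms] by (simp only:)
  then show ?thesis
    using u v by (simp add: word_elt_def r_class)
qed

lemma bar_word_elt:
  assumes "w \<in> words n"
  shows "bar n k (word_elt n k w) = word_elt n k (rev w)"
  unfolding bar_def by (rule the_equality) (use assms word_elt_rev_cong in blast)+


section \<open>Elementary palindromic automorphisms\<close>

definition elem_pal_auts :: "nat \<Rightarrow> nat \<Rightarrow> (word set set \<Rightarrow> word set set) set"
  where "elem_pal_auts n k =
    {\<phi> \<in> auto (free_nilpotent n k).
      \<exists>p \<in> {1..n} \<rightarrow> carrier (free_nilpotent n k). \<forall>i \<in> {1..n}.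
        \<phi> (gen n k i) =
          bar n k (p i) \<otimes>\<^bsub>free_nilpotent n k\<^esub> gen n k i \<otimes>\<^bsub>free_nilpotent n k\<^esub> p i}"

text \<open>A group under composition. As in \<open>AutoGroup\<close>, maps are taken extensional on the carrier.\<close>

definition EPA :: "nat \<Rightarrow> nat \<Rightarrow> (word set set \<Rightarrow> word set set) monoid"
  where "EPA n k = AutoGroup (free_nilpotent n k) \<lparr>carrier := elem_pal_auts n k\<rparr>"

end

theory Submission
  imports Defs "HOL-Algebra.FiniteProduct" "HOL-Algebra.Elementary_Groups"
begin

text \<open>Write $N$ and $A$ for the free nilpotent groups of rank $n$ and steps $2$ and $1$, and let
  $K = \gamma_2 N$, the kernel of the abelianization $N \to A$; it is central in $N$. The
  isomorphism sends an automorphism of $N$ to the automorphism it induces on $A$.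

  The essential point is that reversal acts on $K$ by inversion: it is an anti-homomorphism that is
  trivial modulo $K$, so it sends a commutator $[a,b]$ to $[b^{-1},a^{-1}] = [a,b]^{-1}$
  (\<open>antihom_inverts_commutators\<close>). Hence for $z \in K$ the two factors $z^{-1}$ and $z$ cancel in
  $\overline{pz}\,x\,pz = \overline p\,x\,p$, and the palindrome $\overline p\,x\,p$ depends only on
  the image of $p$ in $A$ (\<open>palindrome_eq_if_abelianize_eq\<close>).

  Injectivity. In $A$ reversal is the identity, so the induced automorphism is
  $x_i \mapsto x_i p_i^2$. It determines $p_i^2$, and therefore $p_i$, since squaring
  is injective in the free abelian group (\<open>free_abelian_square_inj\<close>); by the previous paragraph
  it then determines the automorphism of $N$.

  Surjectivity. Given an elementary palindromic automorphism of $A$, lift each $p_i$ to $N$; the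
  universal property of $N$ gives an endomorphism $x_i \mapsto \overline{p_i}\,x_i\,p_i$ of $N$. It
  is bijective: lift the inverse automorphism of $A$ to any endomorphism of $N$; both composites are
  the identity modulo $K$, and an endomorphism of $N$ that is the identity modulo $K$ fixes $K$
  pointwise as well, which makes it bijective (\<open>endo_bij_if_trivial_mod_commutators\<close>).\<close>

section \<open>Lower central series and homomorphisms\<close>

lemma lower_central_2:
  "lower_central G 2 = generate G {a \<otimes>\<^bsub>G\<^esub> b \<otimes>\<^bsub>G\<^esub> inv\<^bsub>G\<^esub> a \<otimes>\<^bsub>G\<^esub> inv\<^bsub>G\<^esub> b |a b.
      a \<in> carrier G \<and> b \<in> carrier G}"
  by (simp add: numeral_2_eq_2)

lemma lower_central_3:
  "lower_central G 3 = generate G {a \<otimes>\<^bsub>G\<^esub> b \<otimes>\<^bsub>G\<^esub> inv\<^bsub>G\<^esub> a \<otimes>\<^bsub>G\<^esub> inv\<^bsub>G\<^esub> b |a b.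
      a \<in> lower_central G 2 \<and> b \<in> carrier G}"
  by (simp add: numeral_2_eq_2 numeral_3_eq_3)

lemma (in group) subgroup_lower_central: "subgroup (lower_central G m) G"
  using lower_central_normal normal_imp_subgroup by blast

lemma (in group_hom) lower_central_image_subset: "h ` lower_central G m \<subseteq> lower_central H m"
proof (induction m rule: induct_nat_012)
  case (ge2 m)
  let ?S = "{a \<otimes> b \<otimes> inv a \<otimes> inv b |a b. a \<in> lower_central G (Suc m) \<and> b \<in> carrier G}"
  let ?T = "{a \<otimes>\<^bsub>H\<^esub> b \<otimes>\<^bsub>H\<^esub> inv\<^bsub>H\<^esub> a \<otimes>\<^bsub>H\<^esub> inv\<^bsub>H\<^esub> b |a b.
      a \<in> lower_central H (Suc m) \<and> b \<in> carrier H}"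
  note sub = subgroup.subset[OF G.subgroup_lower_central]
  have S: "?S \<subseteq> carrier G" using sub[of "Suc m"] by auto
  have "h ` ?S \<subseteq> ?T"
  proof clarify
    fix a b assume ab: "a \<in> lower_central G (Suc m)" "b \<in> carrier G"
    then have "h (a \<otimes> b \<otimes> inv a \<otimes> inv b) = h a \<otimes>\<^bsub>H\<^esub> h b \<otimes>\<^bsub>H\<^esub> inv\<^bsub>H\<^esub> h a \<otimes>\<^bsub>H\<^esub> inv\<^bsub>H\<^esub> h b"
      using sub[of "Suc m"] by (auto simp: subset_iff)
    moreover have "h a \<in> lower_central H (Suc m)" "h b \<in> carrier H"
      using ge2.IH(2) ab by auto
    ultimately show "\<exists>x y. h (a \<otimes> b \<otimes> inv a \<otimes> inv b) = x \<otimes>\<^bsub>H\<^esub> y \<otimes>\<^bsub>H\<^esub> inv\<^bsub>H\<^esub> x \<otimes>\<^bsub>H\<^esub> inv\<^bsub>H\<^esub> y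
        \<and> x \<in> lower_central H (Suc m) \<and> y \<in> carrier H" by blast
  qed
  then have "generate H (h ` ?S) \<subseteq> generate H ?T"
    by (rule H.mono_generate)
  then show ?case
    by (simp add: generate_img[OF S])
qed auto

lemma (in group_hom) lower_central_image_surj:
  assumes surj: "h ` carrier G = carrier H"
  shows "h ` lower_central G m = lower_central H m"
proof (induction m rule: induct_nat_012)
  case (ge2 m)
  let ?S = "{a \<otimes> b \<otimes> inv a \<otimes> inv b |a b. a \<in> lower_central G (Suc m) \<and> b \<in> carrier G}"
  let ?T = "{a \<otimes>\<^bsub>H\<^esub> b \<otimes>\<^bsub>H\<^esub> inv\<^bsub>H\<^esub> a \<otimes>\<^bsub>H\<^esub> inv\<^bsub>H\<^esub> b |a b.
      a \<in> lower_central H (Suc m) \<and> b \<in> carrier H}"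
  note sub = subgroup.subset[OF G.subgroup_lower_central]
  have S: "?S \<subseteq> carrier G" using sub[of "Suc m"] by auto
  have hc: "h (a \<otimes> b \<otimes> inv a \<otimes> inv b) = h a \<otimes>\<^bsub>H\<^esub> h b \<otimes>\<^bsub>H\<^esub> inv\<^bsub>H\<^esub> h a \<otimes>\<^bsub>H\<^esub> inv\<^bsub>H\<^esub> h b"
    if "a \<in> carrier G" "b \<in> carrier G" for a b
    using that by simp
  have "?T \<subseteq> h ` ?S"
  proof clarify
    fix a b assume "a \<in> lower_central H (Suc m)" "b \<in> carrier H"
    then obtain x y where xy: "x \<in> lower_central G (Suc m)" "y \<in> carrier G" "a = h x" "b = h y"
      using ge2.IH(2) surj by blast
    have x: "x \<in> carrier G" using xy(1) sub[of "Suc m"] by (rule subsetD[rotated])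
    have "x \<otimes> y \<otimes> inv x \<otimes> inv y \<in> ?S" using xy by blast
    then have "h (x \<otimes> y \<otimes> inv x \<otimes> inv y) \<in> h ` ?S" by (rule imageI)
    then show "a \<otimes>\<^bsub>H\<^esub> b \<otimes>\<^bsub>H\<^esub> inv\<^bsub>H\<^esub> a \<otimes>\<^bsub>H\<^esub> inv\<^bsub>H\<^esub> b \<in> h ` ?S"
      unfolding hc[OF x xy(2)] xy(3,4) .
  qed
  then have "generate H ?T \<subseteq> h ` generate G ?S"
    using H.mono_generate[of ?T "h ` ?S"] by (simp add: generate_img[OF S])
  then show ?case
    using lower_central_image_subset[of "Suc (Suc m)"] by (simp add: subset_antisym)
qed (use surj in auto)

lemma (in group) commutator_eq_one_iff:
  assumes "a \<in> carrier G" "b \<in> carrier G"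
  shows "a \<otimes> b \<otimes> inv a \<otimes> inv b = \<one> \<longleftrightarrow> a \<otimes> b = b \<otimes> a"
proof -
  have "a \<otimes> b \<otimes> inv a \<otimes> inv b = (a \<otimes> b) \<otimes> inv (b \<otimes> a)"
    using assms by (simp add: inv_mult_group m_assoc)
  then show ?thesis
    using assms inv_equality[of "a \<otimes> b" "inv (b \<otimes> a)"] by auto
qed

lemma (in comm_group) lower_central_2_trivial: "lower_central G 2 = {\<one>}"
proof -
  have "{a \<otimes> b \<otimes> inv a \<otimes> inv b |a b. a \<in> carrier G \<and> b \<in> carrier G} \<subseteq> {\<one>}"
    using iffD2[OF commutator_eq_one_iff m_comm] by blast
  then have "lower_central G 2 \<subseteq> generate G {\<one>}"
    unfolding lower_central_2 by (rule mono_generate)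
  then show ?thesis
    using generate_one subgroup.one_closed[OF subgroup_lower_central] by auto
qed

lemma (in group) comm_group_if_lower_central_2_trivial:
  assumes "lower_central G 2 = {\<one>}"
  shows "comm_group G"
proof (rule group_comm_groupI)
  fix a b assume ab: "a \<in> carrier G" "b \<in> carrier G"
  then have "a \<otimes> b \<otimes> inv a \<otimes> inv b \<in> lower_central G 2"
    unfolding lower_central_2 by (blast intro: generate.incl)
  then show "a \<otimes> b = b \<otimes> a"
    using assms ab commutator_eq_one_iff by blast
qed

lemma (in group) lower_central_3_trivial:
  assumes "lower_central G 2 = {\<one>}"
  shows "lower_central G 3 = {\<one>}"
proof -
  have "a \<otimes> b \<otimes> inv a \<otimes> inv b = \<one>" if "a = \<one>" "b \<in> carrier G" for a b
    using that by simp
  then have "{a \<otimes> b \<otimes> inv a \<otimes> inv b |a b. a \<in> lower_central G 2 \<and> b \<in> carrier G} \<subseteq> {\<one>}"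
    unfolding assms by blast
  then have "lower_central G 3 \<subseteq> generate G {\<one>}"
    unfolding lower_central_3 by (rule mono_generate)
  then show ?thesis
    using generate_one subgroup.one_closed[OF subgroup_lower_central] by auto
qed


section \<open>Groups of nilpotency class two\<close>

text \<open>Class at most two: abelian groups are included.\<close>

locale class2_group = group +
  assumes class2: "lower_central G 3 = {\<one>}"
begin

lemma lower_central_2_carrier: "z \<in> lower_central G 2 \<Longrightarrow> z \<in> carrier G"
  using subgroup.subset[OF subgroup_lower_central] by auto

lemma commutator_in: "a \<in> carrier G \<Longrightarrow> b \<in> carrier G \<Longrightarrow>
    a \<otimes> b \<otimes> inv a \<otimes> inv b \<in> lower_central G 2"
  unfolding lower_central_2 by (blast intro: generate.incl)

lemma central:
  assumes "z \<in> lower_central G 2" "g \<in> carrier G"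
  shows "z \<otimes> g = g \<otimes> z"
proof -
  have "z \<otimes> g \<otimes> inv z \<otimes> inv g \<in> lower_central G 3"
    unfolding lower_central_3 using assms by (blast intro: generate.incl)
  then show ?thesis
    using assms lower_central_2_carrier commutator_eq_one_iff class2 by auto
qed

text \<open>Central factors drop out of a commutator, so the commutator map factors through the
  abelianization.\<close>

lemma commutator_mod_central:
  assumes ab: "a \<in> carrier G" "b \<in> carrier G"
    and zw: "z \<in> lower_central G 2" "w \<in> lower_central G 2"
  shows "(a \<otimes> z) \<otimes> (b \<otimes> w) \<otimes> inv (a \<otimes> z) \<otimes> inv (b \<otimes> w) = a \<otimes> b \<otimes> inv a \<otimes> inv b"
proof -
  note c = lower_central_2_carrier[OF zw(1)] lower_central_2_carrier[OF zw(2)]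
  have p: "(x \<otimes> u) \<otimes> (y \<otimes> v) = (x \<otimes> y) \<otimes> (u \<otimes> v)"
    if "x \<in> carrier G" "y \<in> carrier G" "u \<in> lower_central G 2" "v \<in> carrier G" for x y u v
  proof -
    note u = lower_central_2_carrier[OF that(3)]
    have "(x \<otimes> u) \<otimes> (y \<otimes> v) = x \<otimes> (u \<otimes> y) \<otimes> v" using that u by (simp add: m_assoc)
    also have "\<dots> = x \<otimes> (y \<otimes> u) \<otimes> v" using central[OF that(3,2)] by simp
    finally show ?thesis using that u by (simp add: m_assoc)
  qed
  have "(a \<otimes> z) \<otimes> (b \<otimes> w) \<otimes> inv (a \<otimes> z) \<otimes> inv (b \<otimes> w)
      = ((a \<otimes> z) \<otimes> (b \<otimes> w)) \<otimes> inv ((b \<otimes> w) \<otimes> (a \<otimes> z))"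
    using ab c by (simp add: inv_mult_group m_assoc)
  also have "\<dots> = (a \<otimes> b) \<otimes> (z \<otimes> w) \<otimes> inv ((b \<otimes> a) \<otimes> (z \<otimes> w))"
    using p ab c zw central[OF zw(1) c(2)] by simp
  also have "\<dots> = (a \<otimes> b) \<otimes> inv (b \<otimes> a)"
  proof -
    have "x \<otimes> t \<otimes> inv (y \<otimes> t) = x \<otimes> inv y"
      if "x \<in> carrier G" "y \<in> carrier G" "t \<in> carrier G" for x y t
    proof -
      have "t \<otimes> (inv t \<otimes> inv y) = inv y"
        using that by (simp flip: m_assoc)
      then show ?thesis using that by (simp add: m_assoc inv_mult_group)
    qed
    then show ?thesis using ab c by simp
  qed
  finally show ?thesis
    using ab by (simp add: inv_mult_group m_assoc)
qed

text \<open>Bilinearity of the commutator in class two: the two signs cancel. Concretely, the left side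
  is the conjugate of $[a,b]$ by $(ba)^{-1}$, and $[a,b]$ is central.\<close>

lemma commutator_inverses:
  assumes ab: "a \<in> carrier G" "b \<in> carrier G"
  shows "inv a \<otimes> inv b \<otimes> inv (inv a) \<otimes> inv (inv b) = a \<otimes> b \<otimes> inv a \<otimes> inv b"
proof -
  let ?c = "a \<otimes> b \<otimes> inv a \<otimes> inv b"
  have c: "?c \<in> carrier G" "b \<otimes> a \<in> carrier G" using ab by auto
  have "a \<otimes> b = ?c \<otimes> (b \<otimes> a)"
  proof -
    have "inv a \<otimes> (inv b \<otimes> (b \<otimes> a)) = \<one>"
      using ab by (simp flip: m_assoc)
    then show ?thesis using ab by (simp add: m_assoc)
  qed
  also have "\<dots> = (b \<otimes> a) \<otimes> ?c"
    by (rule central[OF commutator_in[OF ab] c(2)])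
  finally have "inv (b \<otimes> a) \<otimes> (a \<otimes> b) = inv (b \<otimes> a) \<otimes> ((b \<otimes> a) \<otimes> ?c)"
    by (rule arg_cong)
  then have "inv (b \<otimes> a) \<otimes> (a \<otimes> b) = ?c"
    using c by (simp only: m_assoc[symmetric] inv_closed l_inv l_one)
  then show ?thesis
    using ab by (simp add: inv_mult_group m_assoc)
qed

text \<open>Common to the two uses below, where $\theta$ is congruent modulo commutators either to the
  identity or to inversion: in both cases bilinearity of the commutator yields the hypothesis.\<close>

lemma hom_fixes_lower_central_2:
  assumes hom: "\<theta> \<in> hom G G"
    and fix_comm: "\<And>a b. a \<in> carrier G \<Longrightarrow> b \<in> carrier G \<Longrightarrow>
      \<theta> a \<otimes> \<theta> b \<otimes> inv (\<theta> a) \<otimes> inv (\<theta> b) = a \<otimes> b \<otimes> inv a \<otimes> inv b"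
    and z: "z \<in> lower_central G 2"
  shows "\<theta> z = z"
proof -
  interpret t: group_hom G G \<theta> by unfold_locales (rule hom)
  let ?S = "{a \<otimes> b \<otimes> inv a \<otimes> inv b |a b. a \<in> carrier G \<and> b \<in> carrier G}"
  have S: "?S \<subseteq> carrier G" by auto
  have fS: "\<theta> h = h" if "h \<in> ?S" for h
    using that fix_comm by fastforce
  show ?thesis
    using z unfolding lower_central_2
  proof (induction rule: generate.induct)
    case one
    show ?case by (rule t.hom_one)
  next
    case (incl h)
    then show ?case by (rule fS)
  next
    case (inv h)
    then have "h \<in> carrier G" using S by blast
    then show ?case using fS[OF inv] by simp
  next
    case (eng h1 h2)
    have "h1 \<in> carrier G" "h2 \<in> carrier G"
      using eng(1,2) by (auto intro: generate_in_carrier[OF S])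
    then show ?case using eng(3,4) by simp
  qed
qed

text \<open>Such a $\theta$ is the identity on the commutator subgroup as well as on the quotient. So an
  element of the kernel lies in the commutator subgroup and is fixed; and if $\theta x = xz$ then
  $x z^{-1}$ is a preimage of $x$, since $\theta$ fixes the central element $z$.\<close>

lemma endo_bij_if_trivial_mod_commutators:
  assumes hom: "\<theta> \<in> hom G G"
    and cong: "\<And>x. x \<in> carrier G \<Longrightarrow> \<exists>z\<in>lower_central G 2. \<theta> x = x \<otimes> z"
  shows "bij_betw \<theta> (carrier G) (carrier G)"
proof -
  interpret t: group_hom G G \<theta> by unfold_locales (rule hom)
  have fixed: "\<theta> z = z" if "z \<in> lower_central G 2" for z
  proof (rule hom_fixes_lower_central_2[OF hom _ that])
    fix a b assume ab: "a \<in> carrier G" "b \<in> carrier G"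
    from cong[OF ab(1)] cong[OF ab(2)] obtain z w where
      "z \<in> lower_central G 2" "w \<in> lower_central G 2" "\<theta> a = a \<otimes> z" "\<theta> b = b \<otimes> w" by blast
    then show "\<theta> a \<otimes> \<theta> b \<otimes> inv (\<theta> a) \<otimes> inv (\<theta> b) = a \<otimes> b \<otimes> inv a \<otimes> inv b"
      using commutator_mod_central ab by simp
  qed
  have inj: "inj_on \<theta> (carrier G)"
    unfolding t.inj_on_one_iff
  proof (intro allI impI)
    fix x assume x: "x \<in> carrier G" "\<theta> x = \<one>"
    from cong[OF x(1)] obtain z where z: "z \<in> lower_central G 2" "\<theta> x = x \<otimes> z" by blast
    then have "x = inv z"
      using x lower_central_2_carrier by (simp add: inv_equality)
    then have "x \<in> lower_central G 2"
      using z(1) subgroup.m_inv_closed[OF subgroup_lower_central] by blast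
    then show "x = \<one>" using fixed x by simp
  qed
  have "x \<in> \<theta> ` carrier G" if x: "x \<in> carrier G" for x
  proof -
    from cong[OF x] obtain z where z: "z \<in> lower_central G 2" "\<theta> x = x \<otimes> z" by blast
    note zc = lower_central_2_carrier[OF z(1)]
    have "\<theta> (x \<otimes> inv z) = x"
      using x z zc fixed by (simp add: m_assoc)
    then show ?thesis using x zc by (metis image_eqI inv_closed m_closed)
  qed
  then show ?thesis
    using inj by (auto simp: bij_betw_def)
qed

text \<open>Composing an anti-homomorphism with inversion gives a homomorphism. Here it is congruent to
  inversion modulo commutators, and commutators are unchanged when both entries are inverted.\<close>

lemma antihom_inverts_commutators:
  assumes r: "\<And>x. x \<in> carrier G \<Longrightarrow> r x \<in> carrier G"
    and anti: "\<And>x y. x \<in> carrier G \<Longrightarrow> y \<in> carrier G \<Longrightarrow> r (x \<otimes> y) = r y \<otimes> r x"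
    and cong: "\<And>x. x \<in> carrier G \<Longrightarrow> \<exists>z\<in>lower_central G 2. r x = x \<otimes> z"
    and z: "z \<in> lower_central G 2"
  shows "r z = inv z"
proof -
  have hom: "(\<lambda>x. inv (r x)) \<in> hom G G"
    by (rule homI) (simp_all add: r anti inv_mult_group)
  have "inv (r z) = z"
  proof (rule hom_fixes_lower_central_2[OF hom _ z])
    have inv_r: "\<exists>z\<in>lower_central G 2. inv (r x) = inv x \<otimes> z" if x: "x \<in> carrier G" for x
    proof -
      from cong[OF x] obtain z where z: "z \<in> lower_central G 2" "r x = x \<otimes> z" by blast
      have "inv z \<in> lower_central G 2"
        using z(1) subgroup.m_inv_closed[OF subgroup_lower_central] by blast
      moreover from this have "inv (r x) = inv x \<otimes> inv z"
        using z x lower_central_2_carrier central by (simp add: inv_mult_group)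
      ultimately show ?thesis by blast
    qed
    fix a b assume ab: "a \<in> carrier G" "b \<in> carrier G"
    from inv_r[OF ab(1)] inv_r[OF ab(2)] obtain z w where
      "z \<in> lower_central G 2" "w \<in> lower_central G 2"
      "inv (r a) = inv a \<otimes> z" "inv (r b) = inv b \<otimes> w" by blast
    then show "inv (r a) \<otimes> inv (r b) \<otimes> inv (inv (r a)) \<otimes> inv (inv (r b))
        = a \<otimes> b \<otimes> inv a \<otimes> inv b"
      using commutator_mod_central[of "inv a" "inv b" z w] commutator_inverses ab by simp
  qed
  then show ?thesis
    using r[OF lower_central_2_carrier[OF z]] by (metis inv_inv)
qed

text \<open>$r(pz) = z^{-1}\, r(p)$, and the central factors $z^{-1}$ and $z$ cancel across $x$.\<close>

lemma palindrome_cong: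
  assumes r: "\<And>x. x \<in> carrier G \<Longrightarrow> r x \<in> carrier G"
    and anti: "\<And>x y. x \<in> carrier G \<Longrightarrow> y \<in> carrier G \<Longrightarrow> r (x \<otimes> y) = r y \<otimes> r x"
    and cong: "\<And>x. x \<in> carrier G \<Longrightarrow> \<exists>z\<in>lower_central G 2. r x = x \<otimes> z"
    and x: "x \<in> carrier G" and p: "p \<in> carrier G" and z: "z \<in> lower_central G 2"
  shows "r (p \<otimes> z) \<otimes> x \<otimes> (p \<otimes> z) = r p \<otimes> x \<otimes> p"
proof -
  note zc = lower_central_2_carrier[OF z]
  let ?m = "r p \<otimes> x \<otimes> p"
  have m: "?m \<in> carrier G" using r p x by simp
  have "r (p \<otimes> z) \<otimes> x \<otimes> (p \<otimes> z) = inv z \<otimes> (?m \<otimes> z)"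
    using antihom_inverts_commutators[OF r anti cong z] r p x zc by (simp add: anti m_assoc)
  also have "\<dots> = ?m"
    using m zc by (simp add: central[OF z m, symmetric]) (simp flip: m_assoc)
  finally show ?thesis .
qed

end


section \<open>The universal property of the free nilpotent group\<close>

primrec word_eval :: "('a, 'b) monoid_scheme \<Rightarrow> (nat \<Rightarrow> 'a) \<Rightarrow> word \<Rightarrow> 'a"
  where
    "word_eval H f [] = \<one>\<^bsub>H\<^esub>"
  | "word_eval H f (l # w) =
      (if snd l then f (fst l) else inv\<^bsub>H\<^esub> f (fst l)) \<otimes>\<^bsub>H\<^esub> word_eval H f w"

lemma (in group) word_eval_closed:
  assumes "f \<in> {1..n} \<rightarrow> carrier G" "w \<in> words n"
  shows "word_eval G f w \<in> carrier G"
  using assms(2)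
proof (induction w)
  case (Cons l w)
  then have "w \<in> words n" "f (fst l) \<in> carrier G"
    using assms(1) by (auto simp: words_def)
  then show ?case using Cons.IH by simp
qed simp

lemma (in group) word_eval_append:
  assumes f: "f \<in> {1..n} \<rightarrow> carrier G" and "u \<in> words n" "v \<in> words n"
  shows "word_eval G f (u @ v) = word_eval G f u \<otimes> word_eval G f v"
  using assms(2)
proof (induction u)
  case Nil
  then show ?case using word_eval_closed[OF f assms(3)] by simp
next
  case (Cons l u)
  then have "u \<in> words n" "fst l \<in> {1..n}" by (auto simp: words_def)
  then show ?case
    using Cons.IH word_eval_closed[OF f] f assms(3) by (auto simp: m_assoc Pi_iff)
qed

lemma (in group) word_eval_free_eq:
  assumes f: "f \<in> {1..n} \<rightarrow> carrier G" and "(u, v) \<in> free_eq n"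
  shows "word_eval G f u = word_eval G f v"
  using assms(2)
proof (induction rule: free_eq.induct)
  case (cancel u v i b)
  have w: "[(i, b), (i, \<not> b)] \<in> words n" using cancel by (simp add: words_def)
  have "word_eval G f [(i, b), (i, \<not> b)] = \<one>"
    using cancel f by (auto simp: Pi_iff)
  then show ?case
    using cancel w word_eval_closed[OF f]
    by (simp only: word_eval_append[OF f] words_append l_one)
qed auto

lemma (in group) free_group_lift:
  assumes f: "f \<in> {1..n} \<rightarrow> carrier G"
  shows "\<exists>h \<in> hom (free_group n) G. \<forall>w\<in>words n. h (word_class n w) = word_eval G f w"
proof -
  define h where "h A = word_eval G f (SOME w. w \<in> words n \<and> A = word_class n w)" for A
  have h: "h (word_class n w) = word_eval G f w" if w: "w \<in> words n" for w
  proof -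
    let ?v = "SOME v. v \<in> words n \<and> word_class n w = word_class n v"
    have "?v \<in> words n \<and> word_class n w = word_class n ?v"
      by (rule someI[of _ w]) (simp add: w)
    then have "(w, ?v) \<in> free_eq n"
      using word_class_eq_iff[OF w, of ?v] by blast
    from word_eval_free_eq[OF f this] show ?thesis unfolding h_def by simp
  qed
  moreover have "h \<in> hom (free_group n) G"
  proof (rule homI)
    show "h x \<in> carrier G" if "x \<in> carrier (free_group n)" for x
      using that word_eval_closed[OF f] by (auto simp: carrier_free_group h)
    show "h (x \<otimes>\<^bsub>free_group n\<^esub> y) = h x \<otimes> h y"
      if "x \<in> carrier (free_group n)" "y \<in> carrier (free_group n)" for x y
      using that word_eval_append[OF f]
      by (auto simp: carrier_free_group h mult_word_class words_append)
  qed
  ultimately show ?thesis by blast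
qed

text \<open>The projection $F_n \to N_{n,k}$. It transports the lower central series of the free group,
  which makes $N_{n,k}$ nilpotent of step $k$ and identifies the kernel of abelianization.\<close>

lemma quotient_hom:
  "(\<lambda>x. lower_central (free_group n) (k + 1) #>\<^bsub>free_group n\<^esub> x)
     \<in> hom (free_group n) (free_nilpotent n k)"
  unfolding free_nilpotent_def
  by (rule normal.r_coset_hom_Mod) (rule group.lower_central_normal[OF group_free_group])

lemma mult_word_elt:
  assumes "u \<in> words n" "v \<in> words n"
  shows "word_elt n k u \<otimes>\<^bsub>free_nilpotent n k\<^esub> word_elt n k v = word_elt n k (u @ v)"
  using hom_mult[OF quotient_hom, of "word_class n u" n "word_class n v" k] assms
  by (simp add: word_elt_def carrier_free_group mult_word_class)

lemma one_free_nilpotent: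
  "\<one>\<^bsub>free_nilpotent n k\<^esub> = lower_central (free_group n) (k + 1)"
  by (simp add: free_nilpotent_def FactGroup_def)

lemma one_word_elt: "\<one>\<^bsub>free_nilpotent n k\<^esub> = word_elt n k []"
proof -
  interpret N: group "free_nilpotent n k" by (rule group_free_nilpotent)
  have "word_elt n k [] \<in> carrier (free_nilpotent n k)"
    by (simp add: carrier_free_nilpotent words_Nil)
  then show ?thesis
    using mult_word_elt[OF words_Nil words_Nil, of n k] N.r_cancel_one by simp
qed

lemma word_elt_eq_one_iff:
  assumes "w \<in> words n"
  shows "word_elt n k w = \<one>\<^bsub>free_nilpotent n k\<^esub> \<longleftrightarrow>
      word_class n w \<in> lower_central (free_group n) (k + 1)"
proof -
  interpret F: group "free_group n" by (rule group_free_group)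
  have w: "word_class n w \<in> carrier (free_group n)"
    using assms by (simp add: carrier_free_group)
  show ?thesis
    unfolding one_free_nilpotent word_elt_def
    using F.coset_join1[OF _ w F.subgroup_lower_central]
      F.coset_join2[OF w F.subgroup_lower_central]
      subgroup.subset[OF F.subgroup_lower_central] by blast
qed

lemma lower_central_free_nilpotent:
  "lower_central (free_nilpotent n k) m =
    (\<lambda>x. lower_central (free_group n) (k + 1) #>\<^bsub>free_group n\<^esub> x) ` lower_central (free_group n) m"
proof -
  interpret q: group_hom "free_group n" "free_nilpotent n k"
      "\<lambda>x. lower_central (free_group n) (k + 1) #>\<^bsub>free_group n\<^esub> x"
    using quotient_hom group_free_group group_free_nilpotent
    by (auto intro!: group_hom.intro group_hom_axioms.intro)
  have "(\<lambda>x. lower_central (free_group n) (k + 1) #>\<^bsub>free_group n\<^esub> x) ` carrier (free_group n)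
      = carrier (free_nilpotent n k)"
    unfolding carrier_free_nilpotent carrier_free_group by (simp add: image_image word_elt_def)
  from q.lower_central_image_surj[OF this] show ?thesis by simp
qed

lemma free_nilpotent_nilpotent:
  "lower_central (free_nilpotent n k) (k + 1) = {\<one>\<^bsub>free_nilpotent n k\<^esub>}"
proof -
  interpret F: group "free_group n" by (rule group_free_group)
  note sg = F.subgroup_lower_central[of "k + 1"]
  have "lower_central (free_group n) (k + 1) #>\<^bsub>free_group n\<^esub> x = lower_central (free_group n) (k + 1)"
    if "x \<in> lower_central (free_group n) (k + 1)" for x
    using that subgroup.subset[OF sg] by (intro F.coset_join2[OF _ sg]) auto
  then show ?thesis
    unfolding lower_central_free_nilpotent one_free_nilpotent
    using subgroup.one_closed[OF sg] by (auto simp: image_iff)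
qed

lemma gen_closed: "i \<in> {1..n} \<Longrightarrow> gen n k i \<in> carrier (free_nilpotent n k)"
  by (auto simp: gen_def carrier_free_nilpotent words_def)

lemma word_elt_eq_word_eval:
  assumes "w \<in> words n"
  shows "word_elt n k w = word_eval (free_nilpotent n k) (gen n k) w"
  using assms
proof (induction w)
  case Nil
  then show ?case by (simp add: one_word_elt)
next
  case (Cons l w)
  interpret N: group "free_nilpotent n k" by (rule group_free_nilpotent)
  obtain i b where l: "l = (i, b)" by (cases l)
  have w: "w \<in> words n" and i: "i \<in> {1..n}" and iw: "\<And>c. [(i, c)] \<in> words n"
    using Cons.prems by (auto simp: words_def l)
  have "([(i, False), (i, True)], []) \<in> free_eq n"
    using free_eq.cancel[OF words_Nil words_Nil i, of False] by simp
  then have "word_class n ([(i, False)] @ [(i, True)]) = word_class n []"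
    using iw words_Nil by (subst word_class_eq_iff) (auto simp: words_def)
  then have "word_elt n k [(i, False)] \<otimes>\<^bsub>free_nilpotent n k\<^esub> gen n k i = \<one>\<^bsub>free_nilpotent n k\<^esub>"
    unfolding gen_def by (simp only: mult_word_elt[OF iw iw] one_word_elt) (simp add: word_elt_def)
  then have "word_elt n k [(i, False)] = inv\<^bsub>free_nilpotent n k\<^esub> gen n k i"
    using iw gen_closed[OF i, of k] by (intro N.inv_equality[symmetric]) (auto simp: carrier_free_nilpotent)
  then have "word_elt n k [l] = (if b then gen n k i else inv\<^bsub>free_nilpotent n k\<^esub> gen n k i)"
    by (simp add: gen_def l)
  moreover have "word_elt n k (l # w) = word_elt n k [l] \<otimes>\<^bsub>free_nilpotent n k\<^esub> word_elt n k w"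
    using mult_word_elt[OF iw w] by (simp add: l)
  ultimately show ?case
    using Cons.IH[OF w] by (simp add: l)
qed

lemma hom_word_eval:
  assumes "group G" "group H" "h \<in> hom G H" "f \<in> {1..n} \<rightarrow> carrier G" "w \<in> words n"
  shows "h (word_eval G f w) = word_eval H (\<lambda>i. h (f i)) w"
proof -
  interpret group_hom G H h
    using assms by (simp add: group_hom_def group_hom_axioms_def)
  show ?thesis
    using assms(5)
  proof (induction w)
    case (Cons l w)
    then have "w \<in> words n" "f (fst l) \<in> carrier G" using assms(4) by (auto simp: words_def)
    then show ?case using Cons.IH G.word_eval_closed[OF assms(4)] by simp
  qed simp
qed

lemma hom_word_elt:
  assumes "group H" "h \<in> hom (free_nilpotent n k) H" "w \<in> words n"
  shows "h (word_elt n k w) = word_eval H (\<lambda>i. h (gen n k i)) w"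
  unfolding word_elt_eq_word_eval[OF assms(3)]
  by (rule hom_word_eval[OF group_free_nilpotent assms(1,2) _ assms(3)]) (simp add: gen_closed)

text \<open>The uniqueness half of the universal property of $N_{n,k}$.\<close>

lemma hom_eq_if_eq_on_gens:
  assumes "group H" "h \<in> hom (free_nilpotent n k) H" "h' \<in> hom (free_nilpotent n k) H"
    and gens: "\<And>i. i \<in> {1..n} \<Longrightarrow> h (gen n k i) = h' (gen n k i)"
    and x: "x \<in> carrier (free_nilpotent n k)"
  shows "h x = h' x"
proof -
  obtain w where w: "w \<in> words n" "x = word_elt n k w" using x by (auto simp: carrier_free_nilpotent)
  have "word_eval H (\<lambda>i. h (gen n k i)) w = word_eval H (\<lambda>i. h' (gen n k i)) w"
    using w(1) by (induction w) (auto simp: words_def gens)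
  then show ?thesis
    using w hom_word_elt assms by metis
qed

text \<open>The existence half: the homomorphism from $F_n$ determined by $f$ maps $\gamma_{k+1}F_n$ into
  $\gamma_{k+1}H = 1$, so it factors through $N_{n,k}$.\<close>

lemma free_nilpotent_lift:
  assumes H: "group H" and nil: "lower_central H (k + 1) = {\<one>\<^bsub>H\<^esub>}"
    and f: "f \<in> {1..n} \<rightarrow> carrier H"
  shows "\<exists>h \<in> hom (free_nilpotent n k) H. \<forall>i\<in>{1..n}. h (gen n k i) = f i"
proof -
  interpret H: group H by (rule H)
  interpret F: group "free_group n" by (rule group_free_group)
  let ?N = "lower_central (free_group n) (k + 1)"
  obtain e where e: "e \<in> hom (free_group n) H"
    and e_class: "\<And>w. w \<in> words n \<Longrightarrow> e (word_class n w) = word_eval H f w"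
    using H.free_group_lift[OF f] by blast
  interpret e: group_hom "free_group n" H e by unfold_locales (rule e)
  define h where "h g = word_eval H f (SOME w. w \<in> words n \<and> g = word_elt n k w)" for g
  have h: "h (word_elt n k w) = word_eval H f w" if w: "w \<in> words n" for w
  proof -
    let ?v = "SOME v. v \<in> words n \<and> word_elt n k w = word_elt n k v"
    have v: "?v \<in> words n" "word_elt n k w = word_elt n k ?v"
      using someI[of "\<lambda>v. v \<in> words n \<and> word_elt n k w = word_elt n k v" w] w by auto
    have c: "word_class n w \<in> carrier (free_group n)" "word_class n ?v \<in> carrier (free_group n)"
      using v(1) w by (auto simp: carrier_free_group)
    have "word_class n w \<in> ?N #>\<^bsub>free_group n\<^esub> word_class n ?v"
      using v(2) F.rcos_self[OF c(1) F.subgroup_lower_central[of "k + 1"]] by (simp only: word_elt_def)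
    then obtain a where a: "a \<in> ?N" "word_class n w = a \<otimes>\<^bsub>free_group n\<^esub> word_class n ?v"
      by (auto simp: r_coset_def)
    have "e a = \<one>\<^bsub>H\<^esub>"
      using a(1) e.lower_central_image_subset[of "k + 1"] nil by auto
    moreover have "a \<in> carrier (free_group n)"
      using a(1) subgroup.subset[OF F.subgroup_lower_central] by blast
    ultimately have "e (word_class n w) = e (word_class n ?v)"
      unfolding a(2) using c by simp
    then show ?thesis
      unfolding h_def using e_class v(1) w by simp
  qed
  have "h \<in> hom (free_nilpotent n k) H"
  proof (rule homI)
    show "h x \<in> carrier H" if "x \<in> carrier (free_nilpotent n k)" for x
      using that H.word_eval_closed[OF f] by (auto simp: carrier_free_nilpotent h)
    show "h (x \<otimes>\<^bsub>free_nilpotent n k\<^esub> y) = h x \<otimes>\<^bsub>H\<^esub> h y"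
      if "x \<in> carrier (free_nilpotent n k)" "y \<in> carrier (free_nilpotent n k)" for x y
      using that H.word_eval_append[OF f]
      by (auto simp: carrier_free_nilpotent h mult_word_elt words_append)
  qed
  moreover have "h (gen n k i) = f i" if "i \<in> {1..n}" for i
  proof -
    have "[(i, True)] \<in> words n" using that by (simp add: words_def)
    then show ?thesis using f that by (simp add: gen_def h Pi_iff)
  qed
  ultimately show ?thesis by blast
qed

lemma bar_closed:
  assumes "x \<in> carrier (free_nilpotent n k)"
  shows "bar n k x \<in> carrier (free_nilpotent n k)"
  using assms by (auto simp: carrier_free_nilpotent bar_word_elt words_rev)

lemma bar_mult:
  assumes "x \<in> carrier (free_nilpotent n k)" "y \<in> carrier (free_nilpotent n k)"
  shows "bar n k (x \<otimes>\<^bsub>free_nilpotent n k\<^esub> y) = bar n k y \<otimes>\<^bsub>free_nilpotent n k\<^esub> bar n k x"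
  using assms
  by (auto simp: carrier_free_nilpotent bar_word_elt words_rev mult_word_elt words_append)

lemma bar_gen: "i \<in> {1..n} \<Longrightarrow> bar n k (gen n k i) = gen n k i"
  unfolding gen_def by (subst bar_word_elt) (auto simp: words_def)


section \<open>The free abelian group\<close>

text \<open>Keeps the step $1$ from being rewritten to \<open>Suc 0\<close>, which would hide the facts about
  $N_{n,1}$ from the simplifier.\<close>

declare One_nat_def [simp del]

lemma comm_group_free_abelian: "comm_group (free_nilpotent n 1)"
  using group.comm_group_if_lower_central_2_trivial[OF group_free_nilpotent, of n 1]
    free_nilpotent_nilpotent[of n 1] by (simp add: one_add_one)

text \<open>An anti-homomorphism of a commutative group is a homomorphism, and reversal fixes the
  generators.\<close>

lemma bar_free_abelian:
  assumes x: "x \<in> carrier (free_nilpotent n 1)"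
  shows "bar n 1 x = x"
proof -
  interpret A: comm_group "free_nilpotent n 1" by (rule comm_group_free_abelian)
  have "bar n 1 \<in> hom (free_nilpotent n 1) (free_nilpotent n 1)"
    by (rule homI) (simp_all add: bar_closed bar_mult A.m_comm)
  moreover have "(\<lambda>x. x) \<in> hom (free_nilpotent n 1) (free_nilpotent n 1)"
    by (rule homI) auto
  ultimately show ?thesis
    by (rule hom_eq_if_eq_on_gens[OF A.is_group _ _ _ x]) (simp add: bar_gen)
qed

text \<open>The universal property, applied to maps into $\mathbb Z$, gives the exponent $e_i$ of each
  generator; $a \mapsto \prod_i x_i^{e_i(a)}$ is an endomorphism fixing the generators, hence the
  identity, so an element is determined by its exponents. Squaring doubles them.\<close>

lemma free_abelian_square_inj:
  assumes x: "x \<in> carrier (free_nilpotent n 1)" and y: "y \<in> carrier (free_nilpotent n 1)"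
    and eq: "x \<otimes>\<^bsub>free_nilpotent n 1\<^esub> x = y \<otimes>\<^bsub>free_nilpotent n 1\<^esub> y"
  shows "x = y"
proof -
  let ?A = "free_nilpotent n 1"
  interpret A: comm_group ?A by (rule comm_group_free_abelian)
  have "\<exists>e. e \<in> hom ?A integer_group \<and> (\<forall>j\<in>{1..n}. e (gen n 1 j) = (if j = i then 1 else 0))" for i
    using free_nilpotent_lift[OF group_integer_group,
        of 1 "\<lambda>j. if j = i then 1 else 0" n]
      comm_group.lower_central_2_trivial[OF abelian_integer_group] by auto
  then obtain e where e_hom: "\<And>i. e i \<in> hom ?A integer_group"
    and e_gen: "\<And>i j. j \<in> {1..n} \<Longrightarrow> e i (gen n 1 j) = (if j = i then 1 else 0)"
    by metis
  have e_mult: "e i (a \<otimes>\<^bsub>?A\<^esub> b) = e i a + e i b" if "a \<in> carrier ?A" "b \<in> carrier ?A" for i a b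
    using hom_mult[OF e_hom that] by simp
  \<comment> \<open>Rebuilds an element from its exponents; it is shown to be the identity.\<close>
  define c where "c a = (\<Otimes>\<^bsub>?A\<^esub>i\<in>{1..n}. gen n 1 i [^]\<^bsub>?A\<^esub> e i a)" for a
  have g: "gen n 1 i [^]\<^bsub>?A\<^esub> (t::int) \<in> carrier ?A" if "i \<in> {1..n}" for i t
    using gen_closed[OF that] by (rule A.int_pow_closed)
  have "c \<in> hom ?A ?A"
  proof (rule homI)
    show "c a \<in> carrier ?A" for a
      unfolding c_def using g by (intro A.finprod_closed) auto
    fix a b assume ab: "a \<in> carrier ?A" "b \<in> carrier ?A"
    have "c (a \<otimes>\<^bsub>?A\<^esub> b) =
        (\<Otimes>\<^bsub>?A\<^esub>i\<in>{1..n}. gen n 1 i [^]\<^bsub>?A\<^esub> e i a \<otimes>\<^bsub>?A\<^esub> gen n 1 i [^]\<^bsub>?A\<^esub> e i b)"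
      unfolding c_def e_mult[OF ab] using g
      by (intro A.finprod_cong') (auto simp: A.int_pow_mult gen_closed)
    also have "\<dots> = c a \<otimes>\<^bsub>?A\<^esub> c b"
      unfolding c_def using g by (intro A.finprod_multf) auto
    finally show "c (a \<otimes>\<^bsub>?A\<^esub> b) = c a \<otimes>\<^bsub>?A\<^esub> c b" .
  qed
  moreover have "c (gen n 1 j) = gen n 1 j" if j: "j \<in> {1..n}" for j
  proof -
    have "c (gen n 1 j) = (\<Otimes>\<^bsub>?A\<^esub>i\<in>{1..n}. if j = i then gen n 1 i else \<one>\<^bsub>?A\<^esub>)"
      unfolding c_def using g j
      by (intro A.finprod_cong') (auto simp: e_gen gen_closed A.int_pow_1)
    also have "\<dots> = gen n 1 j"
      using j gen_closed by (intro A.finprod_singleton) auto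
    finally show ?thesis .
  qed
  moreover have "(\<lambda>x. x) \<in> hom ?A ?A" by (rule homI) auto
  ultimately have c_id: "c a = a" if "a \<in> carrier ?A" for a
    using hom_eq_if_eq_on_gens[OF A.is_group, of c n 1 "\<lambda>x. x" a] that by simp
  have "e i x = e i y" for i
    using arg_cong[OF eq, of "e i"] x y by (simp add: e_mult)
  then have "c x = c y" by (simp add: c_def)
  then show ?thesis using c_id x y by simp
qed


section \<open>Abelianization of the free class-two group\<close>

definition abelianize :: "nat \<Rightarrow> word set set \<Rightarrow> word set set"
  where "abelianize n = (SOME h. h \<in> hom (free_nilpotent n 2) (free_nilpotent n 1) \<and>
    (\<forall>i\<in>{1..n}. h (gen n 2 i) = gen n 1 i))"

lemma class2_free_nilpotent: "class2_group (free_nilpotent n 2)"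
proof -
  interpret group "free_nilpotent n 2" by (rule group_free_nilpotent)
  show ?thesis
    using free_nilpotent_nilpotent[of n 2] by unfold_locales simp
qed

interpretation N2: class2_group "free_nilpotent n 2" for n
  by (rule class2_free_nilpotent)

lemma abelianize_hom: "abelianize n \<in> hom (free_nilpotent n 2) (free_nilpotent n 1)"
  and abelianize_gen: "i \<in> {1..n} \<Longrightarrow> abelianize n (gen n 2 i) = gen n 1 i"
proof -
  interpret A: group "free_nilpotent n 1" by (rule group_free_nilpotent)
  have "lower_central (free_nilpotent n 1) (2 + 1) = {\<one>\<^bsub>free_nilpotent n 1\<^esub>}"
    using A.lower_central_3_trivial free_nilpotent_nilpotent[of n 1] by simp
  from free_nilpotent_lift[OF A.is_group this, of "gen n 1" n]
  have "\<exists>h. h \<in> hom (free_nilpotent n 2) (free_nilpotent n 1) \<and>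
      (\<forall>i\<in>{1..n}. h (gen n 2 i) = gen n 1 i)"
    using gen_closed by auto
  from someI_ex[OF this] show "abelianize n \<in> hom (free_nilpotent n 2) (free_nilpotent n 1)"
    and "i \<in> {1..n} \<Longrightarrow> abelianize n (gen n 2 i) = gen n 1 i"
    unfolding abelianize_def by auto
qed

interpretation abelianize:
  group_hom "free_nilpotent n 2" "free_nilpotent n 1" "abelianize n" for n
  by (intro group_hom.intro group_hom_axioms.intro group_free_nilpotent abelianize_hom)

lemma abelianize_word_elt:
  assumes w: "w \<in> words n"
  shows "abelianize n (word_elt n 2 w) = word_elt n 1 w"
proof -
  have "word_eval (free_nilpotent n 1) (\<lambda>i. abelianize n (gen n 2 i)) w
      = word_eval (free_nilpotent n 1) (gen n 1) w"
    using w by (induction w) (auto simp: words_def abelianize_gen)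
  then show ?thesis
    using hom_word_elt[OF group_free_nilpotent abelianize_hom w] word_elt_eq_word_eval[OF w]
    by simp
qed

lemma abelianize_surj: "abelianize n ` carrier (free_nilpotent n 2) = carrier (free_nilpotent n 1)"
  by (auto simp: carrier_free_nilpotent image_image abelianize_word_elt)

lemma abelianize_bar:
  assumes "x \<in> carrier (free_nilpotent n 2)"
  shows "abelianize n (bar n 2 x) = bar n 1 (abelianize n x)"
  using assms by (auto simp: carrier_free_nilpotent bar_word_elt abelianize_word_elt words_rev)

text \<open>A word that is trivial in $N_{n,1}$ represents an element of $\gamma_2 F_n$, whose image in
  $N_{n,2}$ is $\gamma_2 N_{n,2}$.\<close>

lemma abelianize_eq_one_iff:
  assumes "x \<in> carrier (free_nilpotent n 2)"
  shows "abelianize n x = \<one>\<^bsub>free_nilpotent n 1\<^esub> \<longleftrightarrow> x \<in> lower_central (free_nilpotent n 2) 2"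
proof
  assume one: "abelianize n x = \<one>\<^bsub>free_nilpotent n 1\<^esub>"
  obtain w where w: "w \<in> words n" "x = word_elt n 2 w"
    using assms by (auto simp: carrier_free_nilpotent)
  then have "word_class n w \<in> lower_central (free_group n) 2"
    using one word_elt_eq_one_iff[of w n 1] by (simp add: abelianize_word_elt)
  then show "x \<in> lower_central (free_nilpotent n 2) 2"
    unfolding lower_central_free_nilpotent w(2) word_elt_def by (rule imageI)
next
  assume "x \<in> lower_central (free_nilpotent n 2) 2"
  then show "abelianize n x = \<one>\<^bsub>free_nilpotent n 1\<^esub>"
    using abelianize.lower_central_image_subset[of n 2] free_nilpotent_nilpotent[of n 1] by auto
qed

lemma abelianize_eq_iff:
  assumes x: "x \<in> carrier (free_nilpotent n 2)" and y: "y \<in> carrier (free_nilpotent n 2)"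
  shows "abelianize n x = abelianize n y \<longleftrightarrow>
    (\<exists>z\<in>lower_central (free_nilpotent n 2) 2. x = y \<otimes>\<^bsub>free_nilpotent n 2\<^esub> z)"
proof
  let ?N = "free_nilpotent n 2"
  assume eq: "abelianize n x = abelianize n y"
  have "inv\<^bsub>?N\<^esub> y \<otimes>\<^bsub>?N\<^esub> x \<in> lower_central ?N 2"
    using x y eq abelianize_eq_one_iff[of "inv\<^bsub>?N\<^esub> y \<otimes>\<^bsub>?N\<^esub> x" n] by simp
  moreover have "x = y \<otimes>\<^bsub>?N\<^esub> (inv\<^bsub>?N\<^esub> y \<otimes>\<^bsub>?N\<^esub> x)"
    using x y by (simp flip: N2.m_assoc)
  ultimately show "\<exists>z\<in>lower_central ?N 2. x = y \<otimes>\<^bsub>?N\<^esub> z" by blast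
next
  assume "\<exists>z\<in>lower_central (free_nilpotent n 2) 2. x = y \<otimes>\<^bsub>free_nilpotent n 2\<^esub> z"
  then obtain z where z: "z \<in> lower_central (free_nilpotent n 2) 2"
    and xz: "x = y \<otimes>\<^bsub>free_nilpotent n 2\<^esub> z" by blast
  have "z \<in> carrier (free_nilpotent n 2)" using z by (rule N2.lower_central_2_carrier)
  moreover from this have "abelianize n z = \<one>\<^bsub>free_nilpotent n 1\<^esub>"
    using z by (simp add: abelianize_eq_one_iff)
  ultimately show "abelianize n x = abelianize n y"
    using y by (simp add: xz)
qed

text \<open>Reversal is the identity after abelianization, hence trivial modulo commutators, as
  \<open>palindrome_cong\<close> requires.\<close>

lemma palindrome_eq_if_abelianize_eq:
  assumes p: "p \<in> carrier (free_nilpotent n 2)" and q: "q \<in> carrier (free_nilpotent n 2)"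
    and x: "x \<in> carrier (free_nilpotent n 2)" and eq: "abelianize n p = abelianize n q"
  shows "bar n 2 p \<otimes>\<^bsub>free_nilpotent n 2\<^esub> x \<otimes>\<^bsub>free_nilpotent n 2\<^esub> p
    = bar n 2 q \<otimes>\<^bsub>free_nilpotent n 2\<^esub> x \<otimes>\<^bsub>free_nilpotent n 2\<^esub> q"
proof -
  let ?N = "free_nilpotent n 2"
  have cong: "\<exists>z\<in>lower_central ?N 2. bar n 2 a = a \<otimes>\<^bsub>?N\<^esub> z" if a: "a \<in> carrier ?N" for a
  proof -
    have "abelianize n (bar n 2 a) = abelianize n a"
      using a by (simp add: abelianize_bar bar_free_abelian)
    then show ?thesis
      using abelianize_eq_iff[OF bar_closed[OF a] a] by simp
  qed
  obtain z where "z \<in> lower_central ?N 2" "p = q \<otimes>\<^bsub>?N\<^esub> z"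
    using abelianize_eq_iff[OF p q] eq by blast
  then show ?thesis
    using N2.palindrome_cong[where r = "bar n 2", OF bar_closed bar_mult cong x q] by simp
qed


section \<open>Endomorphisms and their abelianizations\<close>

lemma hom_lift_abelianize:
  assumes \<alpha>: "\<alpha> \<in> hom (free_nilpotent n 1) (free_nilpotent n 1)"
    and y: "y \<in> {1..n} \<rightarrow> carrier (free_nilpotent n 2)"
    and eq: "\<And>i. i \<in> {1..n} \<Longrightarrow> abelianize n (y i) = \<alpha> (gen n 1 i)"
  shows "\<exists>\<phi> \<in> hom (free_nilpotent n 2) (free_nilpotent n 2).
    (\<forall>i\<in>{1..n}. \<phi> (gen n 2 i) = y i) \<and>
    (\<forall>x\<in>carrier (free_nilpotent n 2). abelianize n (\<phi> x) = \<alpha> (abelianize n x))"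
proof -
  let ?N = "free_nilpotent n 2" and ?A = "free_nilpotent n 1"
  obtain \<phi> where \<phi>: "\<phi> \<in> hom ?N ?N" "\<And>i. i \<in> {1..n} \<Longrightarrow> \<phi> (gen n 2 i) = y i"
    using free_nilpotent_lift[OF group_free_nilpotent free_nilpotent_nilpotent y] by blast
  have ab: "(abelianize n \<circ> \<phi>) x = (\<alpha> \<circ> abelianize n) x" if "x \<in> carrier ?N" for x
    by (rule hom_eq_if_eq_on_gens[OF group_free_nilpotent
          hom_compose[OF \<phi>(1) abelianize_hom] hom_compose[OF abelianize_hom \<alpha>] _ that])
      (simp add: \<phi>(2) eq abelianize_gen)
  show ?thesis
    using \<phi>(2) ab unfolding o_apply by (intro bexI[OF _ \<phi>(1)]) blast
qed

text \<open>The inverse of $\alpha$ lifts to an endomorphism $\psi$ of $N_{n,2}$ by the universal property.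
  It need not invert $\varphi$, but $\psi\varphi$ and $\varphi\psi$ are the identity modulo commutators
  and so bijective, which is enough.\<close>

lemma bij_if_abelianize_bij:
  assumes \<phi>: "\<phi> \<in> hom (free_nilpotent n 2) (free_nilpotent n 2)"
    and \<alpha>: "\<alpha> \<in> iso (free_nilpotent n 1) (free_nilpotent n 1)"
    and ab: "\<And>x. x \<in> carrier (free_nilpotent n 2) \<Longrightarrow> abelianize n (\<phi> x) = \<alpha> (abelianize n x)"
  shows "bij_betw \<phi> (carrier (free_nilpotent n 2)) (carrier (free_nilpotent n 2))"
proof -
  let ?N = "free_nilpotent n 2" and ?A = "free_nilpotent n 1"
  define \<beta> where "\<beta> = inv_into (carrier ?A) \<alpha>"
  have \<beta>: "\<beta> \<in> hom ?A ?A"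
    using group.iso_set_sym[OF group_free_nilpotent \<alpha>] by (simp add: \<beta>_def iso_def)
  have \<alpha>_bij: "bij_betw \<alpha> (carrier ?A) (carrier ?A)" using \<alpha> by (simp add: iso_def)
  have \<beta>\<alpha>: "\<beta> (\<alpha> a) = a" and \<alpha>\<beta>: "\<alpha> (\<beta> a) = a" if "a \<in> carrier ?A" for a
    using that bij_betw_inv_into_left[OF \<alpha>_bij] bij_betw_inv_into_right[OF \<alpha>_bij]
    by (auto simp: \<beta>_def)
  have "\<forall>i\<in>{1..n}. \<exists>y\<in>carrier ?N. abelianize n y = \<beta> (gen n 1 i)"
    using abelianize_surj[of n] hom_in_carrier[OF \<beta> gen_closed] by (metis imageE)
  then obtain y where y: "\<And>i. i \<in> {1..n} \<Longrightarrow> y i \<in> carrier ?N \<and> abelianize n (y i) = \<beta> (gen n 1 i)"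
    by metis
  then obtain \<psi> where \<psi>: "\<psi> \<in> hom ?N ?N"
    and \<psi>_ab: "\<And>x. x \<in> carrier ?N \<Longrightarrow> abelianize n (\<psi> x) = \<beta> (abelianize n x)"
    using hom_lift_abelianize[OF \<beta>, of y] by auto
  have c: "\<phi> x \<in> carrier ?N" "\<psi> x \<in> carrier ?N" if "x \<in> carrier ?N" for x
    using that \<phi> \<psi> by (auto dest: hom_in_carrier)
  have "bij_betw (\<psi> \<circ> \<phi>) (carrier ?N) (carrier ?N)"
  proof (rule N2.endo_bij_if_trivial_mod_commutators[OF hom_compose[OF \<phi> \<psi>]])
    fix x assume x: "x \<in> carrier ?N"
    then have "abelianize n ((\<psi> \<circ> \<phi>) x) = abelianize n x"
      using c by (simp add: \<psi>_ab ab \<beta>\<alpha>)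
    then show "\<exists>z\<in>lower_central ?N 2. (\<psi> \<circ> \<phi>) x = x \<otimes>\<^bsub>?N\<^esub> z"
      using abelianize_eq_iff[of "(\<psi> \<circ> \<phi>) x" n x] x c by simp
  qed
  then have inj: "inj_on \<phi> (carrier ?N)"
    by (auto simp: bij_betw_def dest: inj_on_imageI2)
  have "bij_betw (\<phi> \<circ> \<psi>) (carrier ?N) (carrier ?N)"
  proof (rule N2.endo_bij_if_trivial_mod_commutators[OF hom_compose[OF \<psi> \<phi>]])
    fix x assume x: "x \<in> carrier ?N"
    then have "abelianize n ((\<phi> \<circ> \<psi>) x) = abelianize n x"
      using c by (simp add: \<psi>_ab ab \<alpha>\<beta>)
    then show "\<exists>z\<in>lower_central ?N 2. (\<phi> \<circ> \<psi>) x = x \<otimes>\<^bsub>?N\<^esub> z"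
      using abelianize_eq_iff[of "(\<phi> \<circ> \<psi>) x" n x] x c by simp
  qed
  then have "carrier ?N = \<phi> ` \<psi> ` carrier ?N"
    by (simp add: bij_betw_def image_comp)
  also have "\<dots> \<subseteq> \<phi> ` carrier ?N"
    using c(2) by (intro image_mono image_subsetI)
  finally have "\<phi> ` carrier ?N = carrier ?N"
    using image_subsetI[of "carrier ?N" \<phi>, OF c(1)] by (rule subset_antisym[rotated])
  then show ?thesis using inj by (simp add: bij_betw_def)
qed

text \<open>Computed on an arbitrary preimage and made extensional, as the automorphism groups demand;
  independence of the preimage is \<open>induced_abelianize\<close>.\<close>

definition induced :: "nat \<Rightarrow> (word set set \<Rightarrow> word set set) \<Rightarrow> word set set \<Rightarrow> word set set"
  where "induced n \<phi> = (\<lambda>a\<in>carrier (free_nilpotent n 1).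
    abelianize n (\<phi> (inv_into (carrier (free_nilpotent n 2)) (abelianize n) a)))"

lemma induced_abelianize:
  assumes \<phi>: "\<phi> \<in> hom (free_nilpotent n 2) (free_nilpotent n 2)"
    and x: "x \<in> carrier (free_nilpotent n 2)"
  shows "induced n \<phi> (abelianize n x) = abelianize n (\<phi> x)"
proof -
  let ?N = "free_nilpotent n 2"
  interpret \<phi>: group_hom ?N ?N \<phi> by unfold_locales (rule \<phi>)
  let ?y = "inv_into (carrier ?N) (abelianize n) (abelianize n x)"
  have y: "?y \<in> carrier ?N" "abelianize n ?y = abelianize n x"
    using inv_into_into[OF imageI[OF x]] f_inv_into_f[OF imageI[OF x]] .
  then obtain z where z: "z \<in> lower_central ?N 2" "?y = x \<otimes>\<^bsub>?N\<^esub> z"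
    using abelianize_eq_iff x by blast
  have "\<phi> z \<in> lower_central ?N 2"
    using \<phi>.lower_central_image_subset z(1) by blast
  moreover have "\<phi> ?y = \<phi> x \<otimes>\<^bsub>?N\<^esub> \<phi> z"
    using z x N2.lower_central_2_carrier by simp
  ultimately have "abelianize n (\<phi> ?y) = abelianize n (\<phi> x)"
    using abelianize_eq_iff[OF \<phi>.hom_closed[OF y(1)] \<phi>.hom_closed[OF x]] by blast
  then show ?thesis using x by (simp add: induced_def)
qed

text \<open>For injectivity: $\varphi$ maps the commutator subgroup onto itself, so $\varphi x$ lies in
  it only if $x$ does.\<close>

lemma induced_auto:
  assumes \<phi>: "\<phi> \<in> auto (free_nilpotent n 2)"
  shows "induced n \<phi> \<in> auto (free_nilpotent n 1)"
proof -
  let ?N = "free_nilpotent n 2" and ?A = "free_nilpotent n 1"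
  have hom: "\<phi> \<in> hom ?N ?N" and bij: "bij_betw \<phi> (carrier ?N) (carrier ?N)"
    using \<phi> by (auto simp: auto_def Bij_def)
  interpret \<phi>: group_hom ?N ?N \<phi> by unfold_locales (rule hom)
  note ind = induced_abelianize[OF hom]
  have rep: "\<exists>x\<in>carrier ?N. a = abelianize n x" if "a \<in> carrier ?A" for a
    using that abelianize_surj[of n] by blast
  have ind_hom: "induced n \<phi> \<in> hom ?A ?A"
  proof (rule homI)
    fix a assume "a \<in> carrier ?A"
    then obtain x where "x \<in> carrier ?N" "a = abelianize n x" using rep by blast
    then show "induced n \<phi> a \<in> carrier ?A" by (simp add: ind)
    fix b assume "b \<in> carrier ?A"
    then obtain y where "y \<in> carrier ?N" "b = abelianize n y" using rep by blast
    then show "induced n \<phi> (a \<otimes>\<^bsub>?A\<^esub> b) = induced n \<phi> a \<otimes>\<^bsub>?A\<^esub> induced n \<phi> b"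
      using ind[of "x \<otimes>\<^bsub>?N\<^esub> y"] \<open>x \<in> carrier ?N\<close> \<open>a = abelianize n x\<close> by (simp add: ind)
  qed
  interpret I: group_hom ?A ?A "induced n \<phi>" by unfold_locales (rule ind_hom)
  have "inj_on (induced n \<phi>) (carrier ?A)"
    unfolding I.inj_on_one_iff
  proof (intro allI impI)
    fix a assume a: "a \<in> carrier ?A" "induced n \<phi> a = \<one>\<^bsub>?A\<^esub>"
    then obtain x where x: "x \<in> carrier ?N" "a = abelianize n x" using rep by blast
    then have "\<phi> x \<in> lower_central ?N 2"
      using a ind abelianize_eq_one_iff by simp
    also have "lower_central ?N 2 = \<phi> ` lower_central ?N 2"
      using \<phi>.lower_central_image_surj bij by (simp add: bij_betw_def)
    finally obtain z where "z \<in> lower_central ?N 2" "\<phi> x = \<phi> z" by blast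
    then have "x \<in> lower_central ?N 2"
      using x(1) bij N2.lower_central_2_carrier by (metis bij_betw_def inj_onD)
    then show "a = \<one>\<^bsub>?A\<^esub>" using x abelianize_eq_one_iff by simp
  qed
  moreover have "carrier ?A \<subseteq> induced n \<phi> ` carrier ?A"
  proof
    fix a assume "a \<in> carrier ?A"
    then obtain y where y: "y \<in> carrier ?N" "a = abelianize n y" using rep by blast
    have "y \<in> \<phi> ` carrier ?N" using y(1) bij by (simp add: bij_betw_def)
    then obtain x where x: "x \<in> carrier ?N" "y = \<phi> x" by blast
    then have "a = induced n \<phi> (abelianize n x)" by (simp add: ind y(2))
    then show "a \<in> induced n \<phi> ` carrier ?A"
      by (rule image_eqI) (rule abelianize.hom_closed[OF x(1)])
  qed
  moreover have "induced n \<phi> ` carrier ?A \<subseteq> carrier ?A"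
    using ind_hom by (auto dest: hom_in_carrier)
  moreover have "induced n \<phi> \<in> extensional (carrier ?A)"
    by (simp add: induced_def)
  ultimately show ?thesis
    using ind_hom by (simp add: auto_def Bij_def bij_betw_def subset_antisym)
qed

lemma induced_compose:
  assumes \<phi>: "\<phi> \<in> auto (free_nilpotent n 2)" and \<psi>: "\<psi> \<in> auto (free_nilpotent n 2)"
  shows "induced n (compose (carrier (free_nilpotent n 2)) \<phi> \<psi>) =
    compose (carrier (free_nilpotent n 1)) (induced n \<phi>) (induced n \<psi>)"
proof
  let ?N = "free_nilpotent n 2" and ?A = "free_nilpotent n 1"
  have hom: "\<phi> \<in> hom ?N ?N" "\<psi> \<in> hom ?N ?N" "compose (carrier ?N) \<phi> \<psi> \<in> hom ?N ?N"
    using \<phi> \<psi> by (auto simp: auto_def N2.hom_compose)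
  fix a
  show "induced n (compose (carrier ?N) \<phi> \<psi>) a =
      compose (carrier ?A) (induced n \<phi>) (induced n \<psi>) a"
  proof (cases "a \<in> carrier ?A")
    case True
    then obtain x where x: "x \<in> carrier ?N" "a = abelianize n x"
      using abelianize_surj[of n] by blast
    then have "\<psi> x \<in> carrier ?N" using hom by (blast dest: hom_in_carrier)
    then show ?thesis
      using x hom by (simp add: induced_abelianize compose_def)
  qed (simp add: induced_def compose_def)
qed


section \<open>Elementary palindromic automorphisms\<close>

lemma elem_pal_autsI:
  assumes "\<phi> \<in> auto (free_nilpotent n k)" and "p \<in> {1..n} \<rightarrow> carrier (free_nilpotent n k)"
    and "\<And>i. i \<in> {1..n} \<Longrightarrow> \<phi> (gen n k i) =
      bar n k (p i) \<otimes>\<^bsub>free_nilpotent n k\<^esub> gen n k i \<otimes>\<^bsub>free_nilpotent n k\<^esub> p i"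
  shows "\<phi> \<in> elem_pal_auts n k"
  unfolding elem_pal_auts_def
  by (intro CollectI conjI bexI[of _ p] ballI) (fact assms)+

lemma induced_elem_pal:
  assumes "\<phi> \<in> elem_pal_auts n 2"
  shows "induced n \<phi> \<in> elem_pal_auts n 1"
proof -
  let ?N = "free_nilpotent n 2" and ?A = "free_nilpotent n 1"
  obtain p where \<phi>: "\<phi> \<in> auto ?N" and p: "p \<in> {1..n} \<rightarrow> carrier ?N"
    and pal: "\<And>i. i \<in> {1..n} \<Longrightarrow> \<phi> (gen n 2 i) = bar n 2 (p i) \<otimes>\<^bsub>?N\<^esub> gen n 2 i \<otimes>\<^bsub>?N\<^esub> p i"
    using assms by (auto simp: elem_pal_auts_def)
  have hom: "\<phi> \<in> hom ?N ?N" using \<phi> by (simp add: auto_def)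
  have "induced n \<phi> (gen n 1 i) =
      bar n 1 (abelianize n (p i)) \<otimes>\<^bsub>?A\<^esub> gen n 1 i \<otimes>\<^bsub>?A\<^esub> abelianize n (p i)"
    if i: "i \<in> {1..n}" for i
  proof -
    have c: "p i \<in> carrier ?N" using p i by blast
    have "induced n \<phi> (gen n 1 i) = abelianize n (\<phi> (gen n 2 i))"
      using induced_abelianize[OF hom gen_closed[OF i]] i by (simp add: abelianize_gen)
    then show ?thesis
      using c i by (simp add: pal gen_closed bar_closed abelianize_bar abelianize_gen)
  qed
  moreover have "(\<lambda>i. abelianize n (p i)) \<in> {1..n} \<rightarrow> carrier ?A" using p by (simp add: Pi_iff)
  ultimately show ?thesis
    using elem_pal_autsI[OF induced_auto[OF \<phi>]] by blast
qed

text \<open>Equality of the induced maps says $a x_i a = b x_i b$ in the free abelian group, where $a$ and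
  $b$ are the images of $p_i$ and $q_i$; cancelling $x_i$ leaves $a^2 = b^2$.\<close>

lemma induced_inj_on: "inj_on (induced n) (elem_pal_auts n 2)"
proof (rule inj_onI)
  let ?N = "free_nilpotent n 2" and ?A = "free_nilpotent n 1"
  interpret A: comm_group ?A by (rule comm_group_free_abelian)
  fix \<phi> \<psi> assume "\<phi> \<in> elem_pal_auts n 2" "\<psi> \<in> elem_pal_auts n 2" and eq: "induced n \<phi> = induced n \<psi>"
  then obtain p q where \<phi>: "\<phi> \<in> auto ?N" and p: "p \<in> {1..n} \<rightarrow> carrier ?N"
    and \<phi>_gen: "\<And>i. i \<in> {1..n} \<Longrightarrow> \<phi> (gen n 2 i) = bar n 2 (p i) \<otimes>\<^bsub>?N\<^esub> gen n 2 i \<otimes>\<^bsub>?N\<^esub> p i"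
    and \<psi>: "\<psi> \<in> auto ?N" and q: "q \<in> {1..n} \<rightarrow> carrier ?N"
    and \<psi>_gen: "\<And>i. i \<in> {1..n} \<Longrightarrow> \<psi> (gen n 2 i) = bar n 2 (q i) \<otimes>\<^bsub>?N\<^esub> gen n 2 i \<otimes>\<^bsub>?N\<^esub> q i"
    by (auto simp: elem_pal_auts_def)
  have hom: "\<phi> \<in> hom ?N ?N" "\<psi> \<in> hom ?N ?N" using \<phi> \<psi> by (auto simp: auto_def)
  have gens: "\<phi> (gen n 2 i) = \<psi> (gen n 2 i)" if i: "i \<in> {1..n}" for i
  proof -
    let ?x = "gen n 1 i" and ?a = "abelianize n (p i)" and ?b = "abelianize n (q i)"
    have c: "p i \<in> carrier ?N" "q i \<in> carrier ?N" "gen n 2 i \<in> carrier ?N"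
      and x: "?x \<in> carrier ?A"
      using p q i gen_closed by auto
    have "abelianize n (\<phi> (gen n 2 i)) = abelianize n (\<psi> (gen n 2 i))"
      using induced_abelianize[OF hom(1) c(3)] induced_abelianize[OF hom(2) c(3)] eq by simp
    then have "?a \<otimes>\<^bsub>?A\<^esub> ?x \<otimes>\<^bsub>?A\<^esub> ?a = ?b \<otimes>\<^bsub>?A\<^esub> ?x \<otimes>\<^bsub>?A\<^esub> ?b"
      using c i
      by (simp add: \<phi>_gen \<psi>_gen bar_closed abelianize_bar bar_free_abelian abelianize_gen)
    then have "?x \<otimes>\<^bsub>?A\<^esub> (?a \<otimes>\<^bsub>?A\<^esub> ?a) = ?x \<otimes>\<^bsub>?A\<^esub> (?b \<otimes>\<^bsub>?A\<^esub> ?b)"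
      using c x by (simp add: A.m_ac)
    then have "?a \<otimes>\<^bsub>?A\<^esub> ?a = ?b \<otimes>\<^bsub>?A\<^esub> ?b"
      using c x by simp
    then have "?a = ?b"
      by (rule free_abelian_square_inj[OF abelianize.hom_closed[OF c(1)] abelianize.hom_closed[OF c(2)]])
    then show ?thesis
      unfolding \<phi>_gen[OF i] \<psi>_gen[OF i] by (rule palindrome_eq_if_abelianize_eq[OF c])
  qed
  show "\<phi> = \<psi>"
  proof (rule extensionalityI)
    show "\<phi> \<in> extensional (carrier ?N)" "\<psi> \<in> extensional (carrier ?N)"
      using \<phi> \<psi> by (auto simp: auto_def Bij_def)
    show "\<phi> x = \<psi> x" if "x \<in> carrier ?N" for x
      using hom_eq_if_eq_on_gens[OF group_free_nilpotent hom gens that] .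
  qed
qed

text \<open>Any choice of lifts $q_i$ of the $p_i$ defines an elementary palindromic endomorphism inducing
  $\alpha$; it is bijective because $\alpha$ is.\<close>

lemma induced_surj_on:
  assumes "\<alpha> \<in> elem_pal_auts n 1"
  shows "\<alpha> \<in> induced n ` elem_pal_auts n 2"
proof -
  let ?N = "free_nilpotent n 2" and ?A = "free_nilpotent n 1"
  obtain p where \<alpha>: "\<alpha> \<in> auto ?A" and p: "p \<in> {1..n} \<rightarrow> carrier ?A"
    and pal: "\<And>i. i \<in> {1..n} \<Longrightarrow> \<alpha> (gen n 1 i) = bar n 1 (p i) \<otimes>\<^bsub>?A\<^esub> gen n 1 i \<otimes>\<^bsub>?A\<^esub> p i"
    using assms by (auto simp: elem_pal_auts_def)
  have \<alpha>_hom: "\<alpha> \<in> hom ?A ?A" and \<alpha>_iso: "\<alpha> \<in> iso ?A ?A" and \<alpha>_ext: "\<alpha> \<in> extensional (carrier ?A)"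
    using \<alpha> by (auto simp: auto_def Bij_def iso_def)
  have "\<forall>i\<in>{1..n}. \<exists>x\<in>carrier ?N. abelianize n x = p i"
  proof
    fix i assume "i \<in> {1..n}"
    then have "p i \<in> abelianize n ` carrier ?N"
      unfolding abelianize_surj using p by blast
    then show "\<exists>x\<in>carrier ?N. abelianize n x = p i" by blast
  qed
  then obtain q where q: "\<And>i. i \<in> {1..n} \<Longrightarrow> q i \<in> carrier ?N"
    and qp: "\<And>i. i \<in> {1..n} \<Longrightarrow> abelianize n (q i) = p i"
    by metis
  let ?y = "\<lambda>i. bar n 2 (q i) \<otimes>\<^bsub>?N\<^esub> gen n 2 i \<otimes>\<^bsub>?N\<^esub> q i"
  have "?y \<in> {1..n} \<rightarrow> carrier ?N"
    using q by (simp add: bar_closed gen_closed)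
  moreover have "abelianize n (?y i) = \<alpha> (gen n 1 i)" if "i \<in> {1..n}" for i
    using that q by (simp add: bar_closed gen_closed abelianize_bar abelianize_gen qp pal)
  ultimately obtain \<phi> where \<phi>: "\<phi> \<in> hom ?N ?N" and \<phi>_gen: "\<And>i. i \<in> {1..n} \<Longrightarrow> \<phi> (gen n 2 i) = ?y i"
    and \<phi>_ab: "\<And>x. x \<in> carrier ?N \<Longrightarrow> abelianize n (\<phi> x) = \<alpha> (abelianize n x)"
    using hom_lift_abelianize[OF \<alpha>_hom, of ?y] by auto
  let ?f = "restrict \<phi> (carrier ?N)"
  have f_hom: "?f \<in> hom ?N ?N"
    using \<phi> by (auto simp: hom_def)
  have "bij_betw ?f (carrier ?N) (carrier ?N)"
    using bij_if_abelianize_bij[OF f_hom \<alpha>_iso] \<phi>_ab by simp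
  then have "?f \<in> auto ?N"
    using f_hom by (simp add: auto_def Bij_def)
  moreover have "?f (gen n 2 i) = ?y i" if "i \<in> {1..n}" for i
    using that \<phi>_gen gen_closed by simp
  moreover have "q \<in> {1..n} \<rightarrow> carrier ?N" using q by blast
  ultimately have "?f \<in> elem_pal_auts n 2"
    by (intro elem_pal_autsI[of ?f n 2 q])
  moreover have "induced n ?f = \<alpha>"
  proof (rule extensionalityI)
    show "induced n ?f \<in> extensional (carrier ?A)" by (simp add: induced_def)
    show "\<alpha> \<in> extensional (carrier ?A)" by (rule \<alpha>_ext)
    fix a assume "a \<in> carrier ?A"
    then obtain x where "x \<in> carrier ?N" "a = abelianize n x" using abelianize_surj[of n] by blast
    then show "induced n ?f a = \<alpha> a"
      using induced_abelianize[OF f_hom] \<phi>_ab by simp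
  qed
  ultimately show ?thesis by blast
qed

theorem proposition3p1:
  fixes n :: nat
  assumes "n \<ge> 1"
  shows "EPA n 2 \<cong> EPA n 1"
proof (rule is_isoI)
  have mult: "f \<otimes>\<^bsub>EPA n k\<^esub> g = compose (carrier (free_nilpotent n k)) f g"
    if "f \<in> elem_pal_auts n k" "g \<in> elem_pal_auts n k" for f g k
    using that by (simp add: EPA_def AutoGroup_def BijGroup_def elem_pal_auts_def auto_def)
  have carrier: "carrier (EPA n k) = elem_pal_auts n k" for k
    by (simp add: EPA_def)
  have "induced n \<in> hom (EPA n 2) (EPA n 1)"
  proof (rule homI; unfold carrier)
    fix \<phi> \<psi> assume "\<phi> \<in> elem_pal_auts n 2" "\<psi> \<in> elem_pal_auts n 2"
    then show "induced n (\<phi> \<otimes>\<^bsub>EPA n 2\<^esub> \<psi>) = induced n \<phi> \<otimes>\<^bsub>EPA n 1\<^esub> induced n \<psi>"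
      using induced_compose[of \<phi> n \<psi>] by (simp add: mult induced_elem_pal) (simp add: elem_pal_auts_def)
  qed (rule induced_elem_pal)
  moreover have "bij_betw (induced n) (carrier (EPA n 2)) (carrier (EPA n 1))"
    using induced_inj_on induced_elem_pal induced_surj_on by (auto simp: bij_betw_def carrier)
  ultimately show "induced n \<in> iso (EPA n 2) (EPA n 1)"
    by (simp add: iso_def)
qed

end
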